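(* Let $N$ be a positive integer and $d\ge 2$. An integer vector $[c_0,\dots,c_d]$ is a geometric progression modulo $N$ such that (1) $c_0,\dots,c_d$ are nonzero, (2) $\gcd(c_0,N)=1$, (3) $[c_0,\dots,c_{d-1}]$ is a rational geometric progression, and (4) $[c_0,\dots,c_{d-1},c_d]$ is not a rational geometric progression, if and only if there exist nonzero integers $a,p,m,k$ such that $\gcd(m,p)=1$, $\gcd(ap,N)=1$, $(am^d-kN)/p$ is a nonzero integer, and $$[c_0,\dots,c_d]=\left[ap^{d-1},ap^{d-2}m,\dots,am^{d-1},\frac{am^d-kN}{p}\right].$$
   Context: An integer vector $[c_0,\dots,c_{\ell-1}]$ is a geometric progression modulo $N$ if there is $r\in\mathbb{Z}/N\mathbb{Z}$ with $c_i\equiv c_0 r^i\pmod N$ for all $0\le i<\ell$. It is a rational geometric progression if there is $\rho\in\mathbb{Q}$ with $c_i=c_0\rho^i$ for all $0\le i<\ell$. *)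

theory Defs
  imports Complex_Main "HOL-Number_Theory.Cong"
begin

text \<open>
  The vector \<open>[c\<^sub>0, \<dots>, c\<^bsub>l-1\<^esub>]\<close> is an integer list of length \<open>l\<close>. The ratio in the ring of
  integers modulo \<open>N\<close> is given by an integer representative \<open>r\<close>.
\<close>

definition geometric_progression_mod :: "int \<Rightarrow> int list \<Rightarrow> bool" where
  "geometric_progression_mod N c \<longleftrightarrow>
     (\<exists>r::int. \<forall>i<length c. [c ! i = c ! 0 * r ^ i] (mod N))"

definition rational_geometric_progression :: "int list \<Rightarrow> bool" where
  "rational_geometric_progression c \<longleftrightarrow>
     (\<exists>\<rho>::rat. \<forall>i<length c. of_int (c ! i) = of_int (c ! 0) * \<rho> ^ i)"

end

theory Submission
  imports Defs
begin

text \<open>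
  A rational geometric progression \<open>c\<^sub>0, \<dots>, c\<^bsub>d-1\<^esub>\<close> with ratio \<open>m/p\<close> in lowest terms has
  \<open>p\<^bsup>d-1\<^esup>\<close> dividing \<open>c\<^sub>0\<close>, so \<open>c\<^sub>i = a p\<^bsup>d-1-i\<^esup> m\<^sup>i\<close>. The ratio is forced by \<open>c\<^sub>0\<close> and \<open>c\<^sub>1\<close>, both over
  the rationals and modulo \<open>N\<close> (where \<open>p\<close> is invertible). Hence appending \<open>c\<^sub>d\<close> keeps the
  progression rational iff \<open>p c\<^sub>d = a m\<^sup>d\<close>, and makes it geometric modulo \<open>N\<close> iff
  \<open>p c\<^sub>d \<equiv> a m\<^sup>d (mod N)\<close>; the integer \<open>k\<close> measures the difference.
\<close>

lemma rational_geometric_progression_homogeneous: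
  fixes c :: "int list"
  assumes "rational_geometric_progression c" and "length c = Suc n"
  obtains a p m :: int where "p > 0" and "coprime m p"
    and "\<And>i. i \<le> n \<Longrightarrow> c ! i = a * p ^ (n - i) * m ^ i"
proof -
  obtain \<rho> :: rat where \<rho>: "\<And>i. i \<le> n \<Longrightarrow> of_int (c ! i) = of_int (c ! 0) * \<rho> ^ i"
    using assms unfolding rational_geometric_progression_def by (auto simp: less_Suc_eq_le)
  obtain m p where mp: "\<rho> = Fract m p" "p > 0" "coprime m p"
    by (cases \<rho>) auto
  have cross: "c ! i * p ^ i = c ! 0 * m ^ i" if "i \<le> n" for i
  proof -
    have "(of_int (c ! i * p ^ i) :: rat) = of_int (c ! 0 * m ^ i)"
      using \<rho>[OF that] mp by (simp add: Fract_of_int_quotient power_divide)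
    then show ?thesis
      by (simp only: of_int_eq_iff)
  qed
  \<comment> \<open>The last index i = n gives the strongest divisibility: coprimality with m^n
    moves the whole power p^n into c_0.\<close>
  have "p ^ n dvd c ! 0 * m ^ n"
    using cross[of n] by (metis dvd_triv_right order_refl)
  moreover have "coprime (p ^ n) (m ^ n)"
    using mp(3) by (simp add: coprime_commute)
  ultimately have "p ^ n dvd c ! 0"
    by (simp add: coprime_dvd_mult_left_iff)
  then obtain a where a: "c ! 0 = a * p ^ n"
    by (metis dvdE mult.commute)
  have "c ! i = a * p ^ (n - i) * m ^ i" if "i \<le> n" for i
  proof -
    have "p ^ n = p ^ (n - i) * p ^ i"
      using that by (simp flip: power_add)
    then have "c ! i * p ^ i = (a * p ^ (n - i) * m ^ i) * p ^ i"
      using cross[OF that] a by (simp add: mult_ac)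
    then show ?thesis
      using mp(2) by simp
  qed
  with mp that show thesis by blast
qed

lemma rational_geometric_progression_if_homogeneous:
  fixes c :: "int list"
  assumes "p \<noteq> 0" and "length c = Suc n"
    and "\<And>i. i \<le> n \<Longrightarrow> c ! i = a * p ^ (n - i) * m ^ i"
  shows "rational_geometric_progression c"
  unfolding rational_geometric_progression_def
proof (intro exI allI impI)
  fix i assume "i < length c"
  then have i: "i \<le> n" using assms(2) by simp
  have "(of_int p :: rat) ^ n = of_int p ^ (n - i) * of_int p ^ i"
    using i by (simp flip: power_add)
  then show "of_int (c ! i) = of_int (c ! 0) * (of_int m / of_int p :: rat) ^ i"
    using assms(1) assms(3)[OF i] assms(3)[of 0] by (simp add: power_divide)
qed

text \<open>Since d \<ge> 2, both c_0 and c_1 lie in the prescribed part, and c_0 is nonzero because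
  a and p are. So c_1 = c_0 \<rho> leaves m/p as the only possible ratio, and only the condition at
  index d remains.\<close>

lemma rational_geometric_progression_extend_iff:
  fixes c :: "int list"
  assumes "a \<noteq> 0" "p \<noteq> 0" "d \<ge> 2" "length c = Suc d"
    and c: "\<And>i. i < d \<Longrightarrow> c ! i = a * p ^ (d - 1 - i) * m ^ i"
  shows "rational_geometric_progression c \<longleftrightarrow> p * c ! d = a * m ^ d"
proof -
  \<comment> \<open>This turns the truncated exponents d - 1 and d - 2 in c_0 and c_1 into
    \<open>Suc e\<close> and \<open>e\<close>.\<close>
  obtain e where d: "d = Suc (Suc e)"
    using \<open>d \<ge> 2\<close> by (metis add_2_eq_Suc le_Suc_ex)
  define \<sigma> :: rat where "\<sigma> = of_int m / of_int p"
  have c0: "c ! 0 = a * p ^ Suc e" and c1: "c ! 1 = a * p ^ e * m"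
    using c[of 0] c[of 1] d by simp_all
  have init: "of_int (c ! i) = of_int (c ! 0) * \<sigma> ^ i" if "i < d" for i
  proof -
    have "(of_int p :: rat) ^ Suc e = of_int p ^ (d - 1 - i) * of_int p ^ i"
      using that d by (simp flip: power_add power_Suc)
    then show ?thesis
      using \<open>p \<noteq> 0\<close> c[OF that] by (simp add: c0 \<sigma>_def power_divide del: power_Suc)
  qed
  have ratio: "\<rho> = \<sigma>" if "of_int (c ! 1) = of_int (c ! 0) * \<rho> ^ 1" for \<rho>
    using that \<open>a \<noteq> 0\<close> \<open>p \<noteq> 0\<close> unfolding c0 c1 \<sigma>_def by (simp add: field_simps)
  have "rational_geometric_progression c \<longleftrightarrow> of_int (c ! d) = of_int (c ! 0) * \<sigma> ^ d"
    unfolding rational_geometric_progression_def \<open>length c = Suc d\<close>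
    using init ratio \<open>d \<ge> 2\<close> by (metis Suc_1 Suc_le_lessD less_Suc_eq)
  \<comment> \<open>As c_0 = a p^(d-1), the value c_0 (m/p)^d is a m^d / p, so exactly one factor p
    has to be cleared.\<close>
  also have "\<dots> \<longleftrightarrow> (of_int (p * c ! d) :: rat) = of_int (a * m ^ d)"
    using \<open>p \<noteq> 0\<close> unfolding c0 \<sigma>_def d by (simp add: field_simps)
  also have "\<dots> \<longleftrightarrow> p * c ! d = a * m ^ d"
    by (simp only: of_int_eq_iff)
  finally show ?thesis .
qed

text \<open>The modular analogue: coprimality with N replaces being nonzero, so a and p can be
  cancelled. That r represents m/p modulo N is expressed as
  \<open>[m = p * r] (mod N)\<close>.\<close>

lemma geometric_progression_mod_extend_iff:
  fixes c :: "int list"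
  assumes "coprime a N" "coprime p N" "d \<ge> 2" "length c = Suc d"
    and c: "\<And>i. i < d \<Longrightarrow> c ! i = a * p ^ (d - 1 - i) * m ^ i"
  shows "geometric_progression_mod N c \<longleftrightarrow> [p * c ! d = a * m ^ d] (mod N)"
proof -
  obtain e where d: "d = Suc (Suc e)"
    using \<open>d \<ge> 2\<close> by (metis add_2_eq_Suc le_Suc_ex)
  have c0: "c ! 0 = a * p ^ Suc e" and c1: "c ! 1 = a * p ^ e * m"
    using c[of 0] c[of 1] d by simp_all
  \<comment> \<open>Stated for every representative r of m/p, so that it serves a given ratio and a
    constructed one alike. Multiplying by p raises the p^(d-1) in c_0 to p^d, which joins r^d to
    form (p r)^d.\<close>
  have last: "[c ! d = c ! 0 * r ^ d] (mod N) \<longleftrightarrow> [p * c ! d = a * m ^ d] (mod N)"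
    if "[m = p * r] (mod N)" for r
  proof -
    have "[c ! d = c ! 0 * r ^ d] (mod N) \<longleftrightarrow> [p * c ! d = p * (c ! 0 * r ^ d)] (mod N)"
      using \<open>coprime p N\<close> by (simp add: cong_mult_lcancel)
    also have "p * (c ! 0 * r ^ d) = a * (p * r) ^ d"
      by (simp add: c0 d power_mult_distrib mult_ac)
    also have "[p * c ! d = a * (p * r) ^ d] (mod N) \<longleftrightarrow> [p * c ! d = a * m ^ d] (mod N)"
      using that by (meson cong_pow cong_scalar_left cong_sym cong_trans)
    finally show ?thesis .
  qed
  show ?thesis
  proof
    assume "geometric_progression_mod N c"
    then obtain r where r: "\<And>i. i \<le> d \<Longrightarrow> [c ! i = c ! 0 * r ^ i] (mod N)"
      using \<open>length c = Suc d\<close> by (auto simp: geometric_progression_mod_def less_Suc_eq_le)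
    \<comment> \<open>Index 1 determines the ratio: cancelling the unit a p^e shows that r
      represents m/p.\<close>
    have "[a * p ^ e * m = a * p ^ e * (p * r)] (mod N)"
      using r[of 1] \<open>d \<ge> 2\<close> unfolding c0 c1 by (simp add: mult_ac)
    then have "[m = p * r] (mod N)"
      using assms(1,2) by (simp add: cong_mult_lcancel)
    then show "[p * c ! d = a * m ^ d] (mod N)"
      using last r by blast
  next
    assume cd: "[p * c ! d = a * m ^ d] (mod N)"
    \<comment> \<open>q inverts p modulo N, so q m represents m/p.\<close>
    obtain q where q: "[p * q = 1] (mod N)"
      using \<open>coprime p N\<close> cong_solve_coprime_int by blast
    define r where "r = q * m"
    have mr: "[m = p * r] (mod N)"
      using cong_scalar_right[OF q, of m] by (simp add: r_def mult_ac cong_sym_eq)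
    have "[c ! i = c ! 0 * r ^ i] (mod N)" if "i < d" for i
    proof -
      \<comment> \<open>Splitting p^i off c_0 lets it join r^i in (p r)^i, which is congruent to
        m^i.\<close>
      have "p ^ Suc e = p ^ (d - 1 - i) * p ^ i"
        using that d by (simp flip: power_add power_Suc)
      then have "c ! 0 * r ^ i = a * p ^ (d - 1 - i) * (p * r) ^ i"
        by (simp add: c0 power_mult_distrib mult_ac del: power_Suc)
      with c[OF that] show ?thesis
        using mr by (simp add: cong_pow cong_scalar_left)
    qed
    with last[OF mr] cd show "geometric_progression_mod N c"
      unfolding geometric_progression_mod_def \<open>length c = Suc d\<close> by (metis less_Suc_eq)
  qed
qed

theorem theorem4p1:
  fixes N :: int and d :: nat and c :: "int list"
  assumes "N > 0" and "d \<ge> 2" and "length c = d + 1"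
  shows "(geometric_progression_mod N c
            \<and> (\<forall>i\<le>d. c ! i \<noteq> 0)
            \<and> gcd (c ! 0) N = 1
            \<and> rational_geometric_progression (take d c)
            \<and> \<not> rational_geometric_progression c)
         \<longleftrightarrow>
         (\<exists>a p m k :: int. a \<noteq> 0 \<and> p \<noteq> 0 \<and> m \<noteq> 0 \<and> k \<noteq> 0
            \<and> gcd m p = 1
            \<and> gcd (a * p) N = 1
            \<and> p dvd (a * m ^ d - k * N)
            \<and> (a * m ^ d - k * N) div p \<noteq> 0
            \<and> c = map (\<lambda>i. a * p ^ (d - 1 - i) * m ^ i) [0..<d] @ [(a * m ^ d - k * N) div p])"
    (is "?L \<longleftrightarrow> ?R")
proof
  assume L: ?L
  have "length (take d c) = Suc (d - 1)"
    using assms by simp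
  moreover have "rational_geometric_progression (take d c)"
    using L by blast
  ultimately obtain a p m where p: "p > 0" and mp: "coprime m p"
    and t: "\<And>i. i \<le> d - 1 \<Longrightarrow> take d c ! i = a * p ^ (d - 1 - i) * m ^ i"
    using rational_geometric_progression_homogeneous by metis
  have c: "c ! i = a * p ^ (d - 1 - i) * m ^ i" if "i < d" for i
    using t[of i] that by simp
  have "c ! 0 \<noteq> 0" "c ! 1 \<noteq> 0" and c0N: "coprime (c ! 0) N"
    using L \<open>d \<ge> 2\<close> by (auto simp: coprime_iff_gcd_eq_1)
  with c[of 0] c[of 1] \<open>d \<ge> 2\<close> have "a \<noteq> 0" "m \<noteq> 0"
    by auto
  have aN: "coprime a N" and pN: "coprime p N"
    using c0N c[of 0] \<open>d \<ge> 2\<close> by auto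
  have "[p * c ! d = a * m ^ d] (mod N)"
    using geometric_progression_mod_extend_iff[OF aN pN \<open>d \<ge> 2\<close> _ c] L assms by simp
  \<comment> \<open>k is the defect a m^d - p c_d divided by N; it is nonzero because the whole
    vector is not a rational progression.\<close>
  then obtain k where k: "a * m ^ d - p * c ! d = k * N"
    by (metis cong_iff_dvd_diff cong_sym dvdE mult.commute)
  then have pc: "a * m ^ d - k * N = p * c ! d"
    by simp
  have "p * c ! d \<noteq> a * m ^ d"
    using rational_geometric_progression_extend_iff[OF \<open>a \<noteq> 0\<close> _ \<open>d \<ge> 2\<close> _ c] L p assms by simp
  with k have "k \<noteq> 0"
    by auto
  have "c = map (\<lambda>i. a * p ^ (d - 1 - i) * m ^ i) [0..<d] @ [(a * m ^ d - k * N) div p]"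
    using c assms p pc by (intro nth_equalityI) (auto simp: nth_append less_Suc_eq)
  moreover have "(a * m ^ d - k * N) div p \<noteq> 0" "p dvd a * m ^ d - k * N"
    using pc p L by auto
  ultimately show ?R
    using \<open>a \<noteq> 0\<close> \<open>m \<noteq> 0\<close> \<open>k \<noteq> 0\<close> p mp aN pN
    by (intro exI[of _ a] exI[of _ p] exI[of _ m] exI[of _ k])
      (simp flip: coprime_iff_gcd_eq_1)
next
  assume ?R
  then obtain a p m k where nz: "a \<noteq> 0" "p \<noteq> 0" "m \<noteq> 0" "k \<noteq> 0"
    and apN: "gcd (a * p) N = 1"
    and dvd: "p dvd a * m ^ d - k * N"
    and cd_nz: "(a * m ^ d - k * N) div p \<noteq> 0"
    and c_eq: "c = map (\<lambda>i. a * p ^ (d - 1 - i) * m ^ i) [0..<d] @ [(a * m ^ d - k * N) div p]"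
    by (elim exE conjE) (rule that; assumption)
  have c: "c ! i = a * p ^ (d - 1 - i) * m ^ i" if "i < d" for i
    using that by (simp add: c_eq nth_append)
  have cd: "c ! d = (a * m ^ d - k * N) div p"
    by (simp add: c_eq nth_append)
  have pcd: "p * c ! d = a * m ^ d - k * N"
    using dvd by (simp add: cd)
  have aN: "coprime a N" and pN: "coprime p N"
    using apN by (simp_all flip: coprime_iff_gcd_eq_1)
  have "geometric_progression_mod N c"
    using geometric_progression_mod_extend_iff[OF aN pN \<open>d \<ge> 2\<close> _ c] pcd assms
    by (simp add: cong_iff_dvd_diff)
  \<comment> \<open>The defect a m^d - p c_d equals k N, which is nonzero since k and N are.\<close>
  moreover have "\<not> rational_geometric_progression c"
    using rational_geometric_progression_extend_iff[OF nz(1,2) \<open>d \<ge> 2\<close> _ c] pcd nz assms by simp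
  moreover have "rational_geometric_progression (take d c)"
    using c assms
    by (intro rational_geometric_progression_if_homogeneous[OF nz(2), where n = "d - 1"]) auto
  moreover have "\<forall>i\<le>d. c ! i \<noteq> 0"
    using c cd cd_nz nz by (auto simp: le_less)
  moreover have "gcd (c ! 0) N = 1"
    using c[of 0] aN pN \<open>d \<ge> 2\<close> by (simp flip: coprime_iff_gcd_eq_1)
  ultimately show ?L
    by blast
qed

end
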